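(* Let $G\colon\mathbb{R}^n\to\mathbb{S}^m$ be continuously differentiable, let $\bar{x}\in\mathbb{R}^n$ satisfy $G(\bar{x})\succeq 0$, and let $r=\operatorname{rank}(G(\bar{x}))$. Then $\bar{x}$ satisfies: 1. Nondegeneracy if, and only if, either $r=m$ or the family $\{v_{ii}(\bar{x},\bar{E}) : i\in\{1,\ldots,m-r\}\}$ is linearly independent for every matrix $\bar{E}\in\mathbb{R}^{m\times (m-r)}$ that spans $\operatorname{Ker} G(\bar{x})$. 2. Robinson's CQ if, and only if, either $r=m$ or the family $\{v_{ii}(\bar{x},\bar{E}) : i\in\{1,\ldots,m-r\}\}$ is positive linearly independent for every matrix $\bar{E}\in\mathbb{R}^{m\times (m-r)}$ that spans $\operatorname{Ker} G(\bar{x})$.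
   Context: $\mathbb{S}^m$ is the space of real symmetric $m\times m$ matrices with inner product $\langle M,N\rangle=\operatorname{trace}(MN)$; $\mathbb{S}^m_+$ is the cone of positive semidefinite matrices, and $M\succeq 0$ means $M\in\mathbb{S}^m_+$. For $x\in\mathbb{R}^n$, $DG(x)[d]=\sum_{\ell=1}^n d_\ell D_{x_\ell}G(x)$ is the derivative of $G$ at $x$, with $D_{x_\ell}G(x)\in\mathbb{S}^m$ the partial derivatives. A matrix $\bar{E}\in\mathbb{R}^{m\times(m-r)}$, where $r=\operatorname{rank}(G(\bar{x}))$, is said to span $\operatorname{Ker} G(\bar{x})$ if $\bar{E}^\top\bar{E}=I_{m-r}$ and $G(\bar{x})\bar{E}=0$. Denoting its columns by $\bar{e}_1,\ldots,\bar{e}_{m-r}$, set $$v_{ij}(\bar{x},\bar{E})=\left[\bar{e}_i^\top D_{x_1}G(\bar{x})\bar{e}_j,\ \ldots,\ \bar{e}_i^\top D_{x_n}G(\bar{x})\bar{e}_j\right]^\top\in\mathbb{R}^n .$$ Nondegeneracy holds at $\bar{x}$ if $\operatorname{Im} DG(\bar{x})+\operatorname{lin}(T_{\mathbb{S}^m_+}(G(\bar{x})))=\mathbb{S}^m$, where $T_{\mathbb{S}^m_+}(G(\bar{x}))$ is the (Bouligand) tangent cone to $\mathbb{S}^m_+$ at $G(\bar{x})$ and $\operatorname{lin}(\cdot)$ denotes the largest linear subspace contained in it; explicitly, $\operatorname{lin}(T_{\mathbb{S}^m_+}(G(\bar{x})))=\{N\in\mathbb{S}^m : \bar{E}^\top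 N\bar{E}=0\}$ for any $\bar{E}$ that spans $\operatorname{Ker} G(\bar{x})$ (and it equals $\mathbb{S}^m$ when $r=m$). Robinson's CQ holds at $\bar{x}$ if there exists $d\in\mathbb{R}^n$ such that $G(\bar{x})+DG(\bar{x})[d]$ is positive definite. A family of vectors $w_1,\ldots,w_p$ (indexed, so repetitions count) is positive linearly independent if $\sum_i\alpha_i w_i=0$ with all $\alpha_i\ge 0$ implies $\alpha_1=\cdots=\alpha_p=0$. Linear independence is likewise understood for indexed families. *)

theory Defs
  imports "HOL-Analysis.Analysis" "HOL-Library.Set_Algebras"
begin

definition sym_mats :: "(real^'m^'m) set" where
  "sym_mats = {M. transpose M = M}"

definition psd_cone :: "(real^'m^'m) set" where
  "psd_cone = {M \<in> sym_mats. \<forall>v. 0 \<le> v \<bullet> (M *v v)}"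

definition pos_definite :: "real^'m^'m \<Rightarrow> bool" where
  "pos_definite M \<longleftrightarrow> M \<in> sym_mats \<and> (\<forall>v. v \<noteq> 0 \<longrightarrow> 0 < v \<bullet> (M *v v))"

definition continuously_differentiable ::
    "('a::real_normed_vector \<Rightarrow> 'b::real_normed_vector) \<Rightarrow> bool" where
  "continuously_differentiable f \<longleftrightarrow>
     (\<exists>f' :: 'a \<Rightarrow> 'a \<Rightarrow>\<^sub>L 'b.
        (\<forall>x. (f has_derivative blinfun_apply (f' x)) (at x)) \<and> continuous_on UNIV f')"

definition partial_derivative ::
    "(real^'n \<Rightarrow> 'b::real_normed_vector) \<Rightarrow> 'n \<Rightarrow> real^'n \<Rightarrow> 'b" where
  "partial_derivative f l x = vector_derivative (\<lambda>t. f (x + t *\<^sub>R axis l 1)) (at 0)"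

definition total_derivative ::
    "(real^'n \<Rightarrow> 'b::real_normed_vector) \<Rightarrow> real^'n \<Rightarrow> real^'n \<Rightarrow> 'b" where
  "total_derivative f x d = (\<Sum>l\<in>UNIV. (d $ l) *\<^sub>R partial_derivative f l x)"

definition bouligand_tangent_cone :: "'a::real_normed_vector set \<Rightarrow> 'a \<Rightarrow> 'a set" where
  "bouligand_tangent_cone S x =
     {d. \<exists>(t :: nat \<Rightarrow> real) (h :: nat \<Rightarrow> 'a).
           (\<forall>k. 0 < t k) \<and> t \<longlonglongrightarrow> 0 \<and> h \<longlonglongrightarrow> d \<and> (\<forall>k. x + t k *\<^sub>R h k \<in> S)}"

text \<open>The largest linear subspace contained in \<open>C\<close>. It exists whenever \<open>C\<close> is a convex
  cone containing the origin, such as the tangent cone of a convex set at one of its points;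
  otherwise the value may be unspecified.\<close>

definition lin :: "'a::real_vector set \<Rightarrow> 'a set" where
  "lin C = (GREATEST V. subspace V \<and> V \<subseteq> C)"

definition nondegenerate :: "(real^'n \<Rightarrow> real^'m^'m) \<Rightarrow> real^'n \<Rightarrow> bool" where
  "nondegenerate G x \<longleftrightarrow>
     range (total_derivative G x) + lin (bouligand_tangent_cone psd_cone (G x)) = sym_mats"

definition robinson_cq :: "(real^'n \<Rightarrow> real^'m^'m) \<Rightarrow> real^'n \<Rightarrow> bool" where
  "robinson_cq G x \<longleftrightarrow> (\<exists>d. pos_definite (G x + total_derivative G x d))"

text \<open>A matrix \<open>E\<close> with \<open>m\<close> rows and \<open>m - r\<close> columns is given by its columns
  \<open>e 0, \<dots>, e (m - r - 1)\<close>, since the number of columns depends on the rank \<open>r\<close> of \<open>M\<close>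
  and so cannot be a type; values of \<open>e\<close> beyond this range are irrelevant. Entrywise,
  \<open>E\<^sup>T E = I\<close> is orthonormality of the columns and \<open>M E = 0\<close> says that each column
  lies in the kernel of \<open>M\<close>.\<close>

definition spans_kernel :: "(nat \<Rightarrow> real^'m) \<Rightarrow> real^'m^'m \<Rightarrow> bool" where
  "spans_kernel e M \<longleftrightarrow>
     (\<forall>i<CARD('m) - rank M. \<forall>j<CARD('m) - rank M. e i \<bullet> e j = (if i = j then 1 else 0)) \<and>
     (\<forall>i<CARD('m) - rank M. M *v e i = 0)"

definition v_vec ::
    "(real^'n \<Rightarrow> real^'m^'m) \<Rightarrow> real^'n \<Rightarrow> (nat \<Rightarrow> real^'m) \<Rightarrow> nat \<Rightarrow> nat \<Rightarrow> real^'n" where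
  "v_vec G x e i j = (\<chi> l. e i \<bullet> (partial_derivative G l x *v e j))"

text \<open>Independence of indexed families (so repeated vectors count), for a finite index set.\<close>

definition lin_indep_family :: "'i set \<Rightarrow> ('i \<Rightarrow> 'a::real_vector) \<Rightarrow> bool" where
  "lin_indep_family I w \<longleftrightarrow>
     (\<forall>\<alpha>. (\<Sum>i\<in>I. \<alpha> i *\<^sub>R w i) = 0 \<longrightarrow> (\<forall>i\<in>I. \<alpha> i = 0))"

definition pos_lin_indep_family :: "'i set \<Rightarrow> ('i \<Rightarrow> 'a::real_vector) \<Rightarrow> bool" where
  "pos_lin_indep_family I w \<longleftrightarrow>
     (\<forall>\<alpha>. (\<forall>i\<in>I. 0 \<le> \<alpha> i) \<and> (\<Sum>i\<in>I. \<alpha> i *\<^sub>R w i) = 0 \<longrightarrow> (\<forall>i\<in>I. \<alpha> i = 0))"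

end

theory Submission imports Defs begin

text \<open>Each constraint qualification fails exactly when there is a nonzero symmetric multiplier \<open>Y\<close>,
  positive semidefinite in the case of Robinson's condition, that is orthogonal to \<open>Im DG(x)\<close> and
  whose range lies in \<open>Ker G(x)\<close>: orthogonal complements give this for nondegeneracy, a separating
  hyperplane for Robinson's condition. Diagonalising \<open>Y\<close> inside the kernel,
  \<open>Y = \<Sum> c\<^sub>i e\<^sub>i e\<^sub>i\<^sup>T\<close>, turns orthogonality to \<open>Im DG(x)\<close> into the linear
  dependence \<open>\<Sum> c\<^sub>i v\<^sub>i\<^sub>i = 0\<close>, so only the diagonal vectors matter once all orthonormal
  bases of the kernel are allowed.\<close>

section \<open>Spectral theorem for self-adjoint maps on invariant subspaces\<close>

text \<open>First-order optimality: \<open>u\<close> minimises a nonnegative quadratic form on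
  \<open>S\<close>, so the directional derivative \<open>2 * (w \<bullet> f u)\<close> must
  vanish.\<close>

lemma quadratic_form_null:
  fixes f :: "'a::euclidean_space \<Rightarrow> 'a"
  assumes "linear f" and sa: "\<And>x y. x \<bullet> f y = f x \<bullet> y" and S: "subspace S"
    and nonneg: "\<And>v. v \<in> S \<Longrightarrow> 0 \<le> v \<bullet> f v"
    and u: "u \<in> S" "u \<bullet> f u = 0" and w: "w \<in> S"
  shows "w \<bullet> f u = 0"
proof -
  define a b where "a = w \<bullet> f u" and "b = w \<bullet> f w"
  have b: "0 \<le> b" using nonneg w by (simp add: b_def)
  \<comment> \<open>The minimiser of \<open>2 * t * a + t^2 * b\<close> would be
    \<open>- a / b\<close>; the denominator \<open>b + 1\<close> covers \<open>b = 0\<close> as well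
    and still makes the value negative unless \<open>a = 0\<close>.\<close>
  define t where "t = - a / (b + 1)"
  have "0 \<le> (u + t *\<^sub>R w) \<bullet> f (u + t *\<^sub>R w)"
    using nonneg S u w by (simp add: subspace_add subspace_scale)
  also have "\<dots> = 2 * t * a + t\<^sup>2 * b"
    using u sa[of u w]
    by (simp add: linear_add[OF assms(1)] linear_scale[OF assms(1)] inner_add_left inner_add_right
        a_def b_def power2_eq_square inner_commute)
  also have "\<dots> = - (a\<^sup>2 * (b + 2)) / (b + 1)\<^sup>2"
    using b by (simp add: t_def divide_simps power2_eq_square) (simp add: algebra_simps)
  finally have "a\<^sup>2 * (b + 2) \<le> 0"
    using b by (simp add: divide_simps split: if_splits)
  then have "a = 0" using b
    by (metis add_nonneg_pos less_eq_real_def linorder_not_less mult_pos_pos zero_less_numeral zero_less_power2)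
  then show ?thesis by (simp add: a_def)
qed

text \<open>A maximiser \<open>u\<close> of the Rayleigh quotient on the unit sphere of
  \<open>S\<close> is an eigenvector: with \<open>c\<close> the maximum,
  \<open>c *\<^sub>R v - f v\<close> defines a nonnegative form on \<open>S\<close> that vanishes at
  \<open>u\<close>.\<close>

lemma selfadjoint_eigenvector:
  fixes f :: "'a::euclidean_space \<Rightarrow> 'a"
  assumes f: "linear f" and sa: "\<And>x y. x \<bullet> f y = f x \<bullet> y" and S: "subspace S"
    and inv: "f ` S \<subseteq> S" and "S \<noteq> {0}"
  obtains u c where "u \<in> S" "norm u = 1" "f u = c *\<^sub>R u"
proof -
  obtain z where z: "z \<in> S" "z \<noteq> 0" using \<open>S \<noteq> {0}\<close> subspace_0[OF S] by blast
  have "compact (sphere 0 1 \<inter> S)"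
    using closed_subspace[OF S] by (simp add: compact_Int_closed)
  moreover have "(1 / norm z) *\<^sub>R z \<in> sphere 0 1 \<inter> S"
    using z subspace_scale[OF S] by simp
  moreover have "continuous_on (sphere 0 1 \<inter> S) (\<lambda>v. v \<bullet> f v)"
    using linear_continuous_on[of f] f by (intro continuous_intros) (simp add: linear_conv_bounded_linear)
  ultimately obtain u where u: "u \<in> S" "norm u = 1"
    and max: "\<And>v. v \<in> S \<Longrightarrow> norm v = 1 \<Longrightarrow> v \<bullet> f v \<le> u \<bullet> f u"
    using continuous_attains_sup[of "sphere 0 1 \<inter> S" "\<lambda>v. v \<bullet> f v"]
    by (metis Int_iff dist_0_norm empty_iff mem_sphere)
  define c where "c = u \<bullet> f u"
  define g where "g v = c *\<^sub>R v - f v" for v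
  have g: "linear g"
    using f by (auto intro!: linearI simp: g_def linear_add linear_scale algebra_simps)
  have nonneg: "0 \<le> v \<bullet> g v" if "v \<in> S" for v
  proof (cases "v = 0")
    case False
    have "((1 / norm v) *\<^sub>R v) \<bullet> f ((1 / norm v) *\<^sub>R v) \<le> c"
      unfolding c_def using False that subspace_scale[OF S] by (intro max) auto
    then have "v \<bullet> f v \<le> c * (norm v * norm v)"
      using False by (simp add: linear_scale[OF f] field_simps)
    then show ?thesis by (simp add: g_def inner_diff_right dot_square_norm power2_eq_square)
  qed simp
  \<comment> \<open>Invariance of \<open>S\<close> allows \<open>g u\<close> itself as the test
    vector, so that \<open>g u\<close> is orthogonal to itself.\<close>
  have "g u \<in> S" using u inv S by (auto simp: g_def subspace_diff subspace_scale image_subset_iff)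
  moreover have "x \<bullet> g y = g x \<bullet> y" for x y
    using sa[of x y] by (simp add: g_def inner_diff_right inner_diff_left)
  moreover have "u \<bullet> g u = 0"
    using u by (simp add: g_def c_def inner_diff_right dot_square_norm)
  ultimately have "g u \<bullet> g u = 0"
    using quadratic_form_null[OF g _ S nonneg u(1)] by blast
  then have "f u = c *\<^sub>R u" by (simp add: g_def)
  with u that show ?thesis by blast
qed

text \<open>Induction on the dimension: self-adjointness makes the orthogonal complement of an
  eigenvector in \<open>S\<close> invariant again. Indices are naturals below \<open>dim S\<close>,
  as \<open>spans_kernel\<close> requires.\<close>

lemma selfadjoint_eigenbasis:
  fixes f :: "'a::euclidean_space \<Rightarrow> 'a"
  assumes f: "linear f" and sa: "\<And>x y. x \<bullet> f y = f x \<bullet> y" and "subspace S" "f ` S \<subseteq> S"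
  shows "\<exists>e c. (\<forall>i<dim S. \<forall>j<dim S. e i \<bullet> e j = (if i = j then 1 else 0)) \<and>
    (\<forall>i<dim S. e i \<in> S \<and> f (e i) = c i *\<^sub>R e i) \<and>
    (\<forall>v\<in>S. v = (\<Sum>i<dim S. (e i \<bullet> v) *\<^sub>R e i))"
  using assms(3,4)
proof (induction "dim S" arbitrary: S)
  case 0
  then have "S \<subseteq> {0}" by simp
  then show ?case unfolding 0(1)[symmetric] by auto
next
  case (Suc n)
  have S: "subspace S" by fact
  have "S \<noteq> {0}" using Suc.hyps(2) by auto
  then obtain u a where u: "u \<in> S" "norm u = 1" "f u = a *\<^sub>R u"
    using selfadjoint_eigenvector[OF f sa S] Suc.prems by blast
  have uu: "u \<bullet> u = 1" using u by (simp add: dot_square_norm)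
  define S' where "S' = {v \<in> S. u \<bullet> v = 0}"
  have "{y \<in> S. \<forall>x\<in>span {u}. orthogonal x y} = S'"
    by (auto simp: S'_def span_singleton orthogonal_def)
  moreover have "dim (span {u}) = 1"
    using uu by (auto simp: dim_span)
  ultimately have "dim S' + 1 = dim S"
    using dim_subspace_orthogonal_to_vectors[of "span {u}" S] S u
    by (simp add: span_minimal)
  then have n: "n = dim S'" using Suc.hyps(2) by simp
  have sub: "subspace S'"
    using S by (auto simp: S'_def subspace_def inner_add_right)
  have "f ` S' \<subseteq> S'"
    using Suc.prems(2) by (auto simp: S'_def sa u)
  from Suc.hyps(1)[OF n sub this] obtain e c where
    e: "\<And>i j. i < n \<Longrightarrow> j < n \<Longrightarrow> e i \<bullet> e j = (if i = j then 1 else 0)"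
       "\<And>i. i < n \<Longrightarrow> e i \<in> S' \<and> f (e i) = c i *\<^sub>R e i"
       "\<And>v. v \<in> S' \<Longrightarrow> v = (\<Sum>i<n. (e i \<bullet> v) *\<^sub>R e i)"
    unfolding n by blast
  have eu: "e i \<bullet> u = 0" "u \<bullet> e i = 0" if "i < n" for i
    using e(2)[OF that] by (auto simp: S'_def inner_commute)
  have "v = (\<Sum>i<Suc n. ((e(n := u)) i \<bullet> v) *\<^sub>R (e(n := u)) i)" if "v \<in> S" for v
  proof -
    have "v - (u \<bullet> v) *\<^sub>R u \<in> S'"
      using that u S by (auto simp: S'_def subspace_diff subspace_scale inner_diff_right uu)
    then have "v - (u \<bullet> v) *\<^sub>R u = (\<Sum>i<n. (e i \<bullet> (v - (u \<bullet> v) *\<^sub>R u)) *\<^sub>R e i)"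
      by (rule e(3))
    also have "\<dots> = (\<Sum>i<n. (e i \<bullet> v) *\<^sub>R e i)"
      by (intro sum.cong) (auto simp: inner_diff_right eu)
    finally show ?thesis by (simp add: algebra_simps)
  qed
  moreover have "\<forall>i<Suc n. (e(n := u)) i \<in> S \<and> f ((e(n := u)) i) = (c(n := a)) i *\<^sub>R (e(n := u)) i"
    using e(2) u by (auto simp: less_Suc_eq S'_def)
  moreover have "\<forall>i<Suc n. \<forall>j<Suc n. (e(n := u)) i \<bullet> (e(n := u)) j = (if i = j then 1 else 0)"
    using e(1) uu eu by (auto simp: less_Suc_eq)
  ultimately show ?case unfolding Suc.hyps(2)[symmetric] by blast
qed

section \<open>Rank-one matrices, symmetric matrices and kernels\<close>

definition outer :: "real^'n \<Rightarrow> real^'m \<Rightarrow> real^'m^'n" where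
  "outer u v = (\<chi> i j. u $ i * v $ j)"

text \<open>The inner product here is entrywise, hence \<open>trace (M N)\<close> on symmetric
  matrices. Pairing with rank-one matrices turns statements about a matrix multiplier into
  statements about vectors.\<close>

lemma inner_outer: "M \<bullet> outer u v = u \<bullet> (M *v v)"
  by (simp add: outer_def inner_vec_def matrix_vector_mult_def sum_distrib_left algebra_simps)

lemma outer_mult_vec: "outer u v *v w = (v \<bullet> w) *\<^sub>R u"
  by (simp add: outer_def inner_vec_def matrix_vector_mult_def vec_eq_iff sum_distrib_left
      sum_distrib_right algebra_simps)

lemma transpose_outer: "transpose (outer u v) = outer v u"
  by (simp add: outer_def transpose_def vec_eq_iff)

lemma linear_matrix_vector_left: "linear (\<lambda>M::real^'n^'m. M *v v)"
  by (auto intro!: linearI simp: matrix_vector_mult_add_rdistrib scaleR_matrix_vector_assoc)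

lemma linear_transpose: "linear (transpose :: real^'n^'m \<Rightarrow> real^'m^'n)"
  by (auto intro!: linearI simp: transpose_def vec_eq_iff)

lemma subspace_sym_mats: "subspace (sym_mats :: (real^'m^'m) set)"
  by (auto simp: subspace_def sym_mats_def linear_add[OF linear_transpose]
      linear_scale[OF linear_transpose] linear_0[OF linear_transpose])

lemma sym_mats_selfadjoint: "M \<in> sym_mats \<Longrightarrow> u \<bullet> (M *v v) = (M *v u) \<bullet> v"
  by (metis (mono_tags, lifting) dot_lmul_matrix mem_Collect_eq sym_mats_def transpose_matrix_vector)

lemma inner_transpose: "transpose M \<bullet> transpose N = M \<bullet> (N :: real^'n^'m)"
  unfolding inner_vec_def transpose_def by simp (rule sum.swap)

lemma quadratic_form_add_scaled_mat:
  "v \<bullet> ((M + c *\<^sub>R mat 1) *v v) = v \<bullet> (M *v v) + c * (v \<bullet> (v :: real^'m))"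
  by (simp add: matrix_vector_mult_add_rdistrib scaleR_matrix_vector_assoc[symmetric] inner_add_right)

text \<open>The kernel is the orthogonal complement of the row space. This identifies the column
  count in \<open>spans_kernel\<close> with the dimension of the kernel.\<close>

lemma dim_kernel: "dim {v. M *v v = 0} = CARD('n) - rank (M :: real^'n^'m)"
proof -
  have "{v \<in> UNIV. \<forall>x\<in>span (rows M). orthogonal x v} = {v. M *v v = 0}" (is "?L = ?R")
  proof (intro set_eqI iffI; simp)
    fix v assume v: "\<forall>x\<in>span (rows M). orthogonal x v"
    have "(M *v v) $ i = 0" for i
    proof -
      have "M $ i \<in> span (rows M)"
        by (rule span_base) (auto simp: rows_def row_def)
      with v show ?thesis by (auto simp: matrix_vector_mul_component orthogonal_def)
    qed
    then show "M *v v = 0" by (simp add: vec_eq_iff)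
  next
    fix v assume v: "M *v v = 0"
    have "orthogonal v x" if "x \<in> span (rows M)" for x
      using that
    proof (rule orthogonal_to_span)
      fix y assume "y \<in> rows M"
      then obtain i where "y = M $ i" by (auto simp: rows_def row_def)
      then show "orthogonal v y"
        using v by (metis inner_commute matrix_vector_mul_component orthogonal_def zero_index)
    qed
    then show "\<forall>x\<in>span (rows M). orthogonal x v" by (simp add: orthogonal_commute)
  qed
  moreover have "dim (span (rows M)) = rank M" by (simp add: row_rank_def)
  ultimately show ?thesis
    using dim_subspace_orthogonal_to_vectors[of "span (rows M)" "UNIV :: (real^'n) set"] by simp
qed

lemma subspace_matrix_kernel: "subspace {v. M *v v = (0 :: real^'m)}"
  by (auto simp: subspace_def matrix_vector_right_distrib matrix_vector_mult_scaleR)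

lemma kernel_decomposition:
  fixes M :: "real^'n^'m"
  obtains u w where "M *v u = 0" "\<And>k. M *v k = 0 \<Longrightarrow> w \<bullet> k = 0" "v = u + w"
proof -
  have span: "span {v. M *v v = 0} = {v. M *v v = 0}"
    using subspace_matrix_kernel[of M] by (simp add: span_eq_iff)
  obtain u w where "u \<in> span {v. M *v v = 0}" "\<And>k. k \<in> span {v. M *v v = 0} \<Longrightarrow> orthogonal w k"
    "v = u + w"
    using orthogonal_subspace_decomp_exists[of "{v. M *v v = 0}" v] by blast
  then show ?thesis
    by (intro that[of u w]) (auto simp: span orthogonal_def)
qed

text \<open>Since the range of \<open>Y\<close> lies in \<open>Ker A\<close>, that kernel is
  invariant under \<open>Y\<close> and has an orthonormal eigenbasis; by symmetry \<open>Y\<close>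
  vanishes on its orthogonal complement, so nothing else contributes.\<close>

lemma symmetric_spectral_decomposition:
  fixes Y A :: "real^'m^'m"
  assumes Y: "Y \<in> sym_mats" and ran: "\<And>u. A *v (Y *v u) = 0"
  obtains e c where "spans_kernel e A"
    "\<And>i. i < CARD('m) - rank A \<Longrightarrow> Y *v e i = c i *\<^sub>R e i"
    "Y = (\<Sum>i<CARD('m) - rank A. c i *\<^sub>R outer (e i) (e i))"
proof -
  let ?K = "{v. A *v v = 0}" and ?p = "CARD('m) - rank A"
  obtain e c where e: "\<forall>i<?p. \<forall>j<?p. e i \<bullet> e j = (if i = j then 1 else 0)"
    "\<forall>i<?p. e i \<in> ?K \<and> Y *v e i = c i *\<^sub>R e i" "\<forall>v\<in>?K. v = (\<Sum>i<?p. (e i \<bullet> v) *\<^sub>R e i)"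
    using selfadjoint_eigenbasis[of "(*v) Y" ?K] sym_mats_selfadjoint[OF Y] ran
      subspace_matrix_kernel[of A] unfolding dim_kernel by (auto simp: image_subset_iff)
  have "Y *v v = (\<Sum>i<?p. c i *\<^sub>R outer (e i) (e i)) *v v" for v
  proof -
    obtain k w where kw: "A *v k = 0" "\<And>k. A *v k = 0 \<Longrightarrow> w \<bullet> k = 0" "v = k + w"
      using kernel_decomposition[of A v] by blast
    \<comment> \<open>\<open>Y *v w = 0\<close>, because \<open>Y *v (Y *v w)\<close> lies in the
      kernel of \<open>A\<close> and \<open>w\<close> is orthogonal to it.\<close>
    have "(Y *v w) \<bullet> (Y *v w) = w \<bullet> (Y *v (Y *v w))"
      using sym_mats_selfadjoint[OF Y] by simp
    also have "\<dots> = 0" using kw(2) ran by simp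
    finally have "Y *v v = Y *v k" by (simp add: kw matrix_vector_right_distrib)
    also have "\<dots> = Y *v (\<Sum>i<?p. (e i \<bullet> k) *\<^sub>R e i)" using e(3) kw(1) by simp
    also have "\<dots> = (\<Sum>i<?p. (e i \<bullet> k) *\<^sub>R c i *\<^sub>R e i)"
      using e(2) by (simp add: linear_sum[OF matrix_vector_mul_linear] matrix_vector_mult_scaleR)
    also have "\<dots> = (\<Sum>i<?p. (c i *\<^sub>R outer (e i) (e i)) *v v)"
      using e(2) kw(2)
      by (intro sum.cong) (auto simp: scaleR_matrix_vector_assoc[symmetric] outer_mult_vec kw(3)
          inner_add_right inner_commute[of "e _" w])
    also have "\<dots> = (\<Sum>i<?p. c i *\<^sub>R outer (e i) (e i)) *v v"
      by (rule linear_sum[OF linear_matrix_vector_left, symmetric])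
    finally show ?thesis .
  qed
  then have "Y = (\<Sum>i<?p. c i *\<^sub>R outer (e i) (e i))" by (simp add: matrix_eq)
  moreover have "spans_kernel e A" using e(1,2) by (simp add: spans_kernel_def)
  ultimately show ?thesis using e(2) by (intro that[of e c]) auto
qed

section \<open>Tangent cone of the semidefinite cone and its lineality space\<close>

text \<open>Such a \<open>v\<close> minimises the form of \<open>A\<close>, so \<open>A *v v\<close>
  is orthogonal to every vector, itself included.\<close>

lemma psd_cone_null:
  assumes "A \<in> psd_cone" "v \<bullet> (A *v v) = 0"
  shows "A *v v = 0"
proof -
  have "(A *v v) \<bullet> (A *v v) = 0"
  proof (rule quadratic_form_null[of "(*v) A" UNIV])
    show "u \<bullet> (A *v w) = (A *v u) \<bullet> w" for u w
      using assms(1) by (intro sym_mats_selfadjoint) (simp add: psd_cone_def)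
  qed (use assms in \<open>simp_all add: psd_cone_def\<close>)
  then show ?thesis by simp
qed

text \<open>Both properties hold for each \<open>h k\<close>: on the kernel of \<open>A\<close> only
  the term \<open>t k *\<^sub>R h k\<close> survives. Both are closed conditions and pass to the
  limit.\<close>

lemma tangent_cone_psd_coneD:
  assumes A: "A \<in> psd_cone" and N: "N \<in> bouligand_tangent_cone psd_cone A"
  shows "N \<in> sym_mats" "A *v v = 0 \<Longrightarrow> 0 \<le> v \<bullet> (N *v v)"
proof -
  obtain t :: "nat \<Rightarrow> real" and h where t: "\<And>k. 0 < t k" and h: "h \<longlonglongrightarrow> N"
    and psd: "\<And>k. A + t k *\<^sub>R h k \<in> psd_cone"
    using N by (auto simp: bouligand_tangent_cone_def)
  have hsym: "h k \<in> sym_mats" for k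
  proof -
    have "(1 / t k) *\<^sub>R ((A + t k *\<^sub>R h k) - A) \<in> sym_mats"
      using psd[of k] A
      by (intro subspace_scale subspace_diff subspace_sym_mats) (auto simp: psd_cone_def)
    then show ?thesis using t[of k] by simp
  qed
  show "N \<in> sym_mats"
    using closed_sequentially[OF closed_subspace[OF subspace_sym_mats] hsym h] .
  assume v: "A *v v = 0"
  have "0 \<le> v \<bullet> (h k *v v)" for k
  proof -
    have "0 \<le> v \<bullet> ((A + t k *\<^sub>R h k) *v v)" using psd[of k] by (auto simp: psd_cone_def)
    then show ?thesis using t[of k] v
      by (simp add: matrix_vector_mult_add_rdistrib scaleR_matrix_vector_assoc[symmetric]
          zero_le_mult_iff)
  qed
  moreover have "(\<lambda>k. v \<bullet> (h k *v v)) \<longlonglongrightarrow> v \<bullet> (N *v v)"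
    using bounded_linear.tendsto[OF _ h, of "\<lambda>M. M *v v"]
      linear_matrix_vector_left[of v, unfolded linear_conv_bounded_linear]
    by (intro tendsto_intros)
  ultimately show "0 \<le> v \<bullet> (N *v v)"
    by (meson LIMSEQ_le_const)
qed

text \<open>The constant is the minimum of the form on the unit sphere of the complement of the
  kernel. It is positive, since a zero would lie both in the kernel and in its complement.\<close>

lemma psd_cone_coercive:
  assumes A: "(A :: real^'m^'m) \<in> psd_cone"
  obtains l where "0 < l"
    "\<And>w. (\<And>k. A *v k = 0 \<Longrightarrow> w \<bullet> k = 0) \<Longrightarrow> l * (norm w)\<^sup>2 \<le> w \<bullet> (A *v w)"
proof -
  define W where "W = {w. \<forall>k. A *v k = 0 \<longrightarrow> w \<bullet> k = 0}"
  have W: "subspace W" by (auto simp: W_def subspace_def inner_add_left)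
  show ?thesis
  proof (cases "sphere 0 1 \<inter> W = {}")
    \<comment> \<open>The complement is trivial, so any positive constant serves.\<close>
    case True
    have "w = 0" if "w \<in> W" for w
    proof (rule ccontr)
      assume "w \<noteq> 0"
      then have "(1 / norm w) *\<^sub>R w \<in> sphere 0 1 \<inter> W"
        using subspace_scale[OF W that] by simp
      with True show False by blast
    qed
    then show ?thesis by (intro that[of 1]) (force simp: W_def)+
  next
    case False
    have "compact (sphere 0 1 \<inter> W)" using closed_subspace[OF W] by (simp add: compact_Int_closed)
    moreover have "continuous_on (sphere 0 1 \<inter> W) (\<lambda>v. v \<bullet> (A *v v))"
      by (intro continuous_intros linear_continuous_on) (simp add: linear_conv_bounded_linear[symmetric])
    ultimately obtain z where z: "norm z = 1" "z \<in> W"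
      and min: "\<And>v. norm v = 1 \<Longrightarrow> v \<in> W \<Longrightarrow> z \<bullet> (A *v z) \<le> v \<bullet> (A *v v)"
      using continuous_attains_inf[of "sphere 0 1 \<inter> W" "\<lambda>v. v \<bullet> (A *v v)"] False
      by (metis Int_iff dist_0_norm mem_sphere)
    have "z \<bullet> (A *v z) \<noteq> 0"
    proof
      assume "z \<bullet> (A *v z) = 0"
      then have "z \<bullet> z = 0" using psd_cone_null[OF A] z by (simp add: W_def)
      with z show False by simp
    qed
    then have pos: "0 < z \<bullet> (A *v z)" using A by (auto simp: psd_cone_def less_le)
    have "z \<bullet> (A *v z) * (norm w)\<^sup>2 \<le> w \<bullet> (A *v w)" if "w \<in> W" for w
    proof (cases "w = 0")
      case False
      then have "z \<bullet> (A *v z) \<le> ((1 / norm w) *\<^sub>R w) \<bullet> (A *v ((1 / norm w) *\<^sub>R w))"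
        using subspace_scale[OF W that] by (intro min) auto
      then show ?thesis using False
        by (simp add: matrix_vector_mult_scaleR field_simps power2_eq_square)
    qed simp
    then show ?thesis using that[OF pos] by (auto simp: W_def)
  qed
qed

text \<open>The approximating directions are \<open>N + t c I\<close>: the cross terms of \<open>N\<close> between the kernel of
  \<open>A\<close> and its orthogonal complement are absorbed by \<open>t\<^sup>2 c I\<close> on the former and by \<open>A\<close> on the
  latter.\<close>

lemma tangent_cone_psd_coneI:
  assumes A: "(A :: real^'m^'m) \<in> psd_cone" and N: "N \<in> sym_mats"
    and null: "\<And>v. A *v v = 0 \<Longrightarrow> v \<bullet> (N *v v) = 0"
  shows "N \<in> bouligand_tangent_cone psd_cone A"
proof -
  obtain l where l: "0 < l"
    and coercive: "\<And>w. (\<And>k. A *v k = 0 \<Longrightarrow> w \<bullet> k = 0) \<Longrightarrow> l * (norm w)\<^sup>2 \<le> w \<bullet> (A *v w)"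
    using psd_cone_coercive[OF A] by blast
  obtain n where n: "0 < n" and bound: "\<And>v. norm (N *v v) \<le> norm v * n"
    using bounded_linear.pos_bounded[of "(*v) N"] by (auto simp: linear_conv_bounded_linear[symmetric])
  \<comment> \<open>\<open>c\<close> is chosen to complete the square in \<open>norm u\<close> and
    \<open>norm w\<close> below; the scale of \<open>t\<close> ensures
    \<open>t k * n \<le> l / 2\<close>, so half of the coercivity of \<open>A\<close> absorbs
    \<open>w \<bullet> (N *v w)\<close> and the other half enters the square.\<close>
  define c where "c = 2 * n\<^sup>2 / l"
  define t where "t k = l / (2 * n) * inverse (real (Suc k))" for k
  define h where "h k = N + (t k * c) *\<^sub>R mat 1" for k
  have t: "0 < t k" "t k * n \<le> l / 2" for k
    using l n by (auto simp: t_def divide_simps)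
  have t0: "t \<longlonglongrightarrow> 0"
    unfolding t_def using tendsto_mult_right_zero[OF LIMSEQ_inverse_real_of_nat] .
  have "h \<longlonglongrightarrow> N + (0 * c) *\<^sub>R mat 1"
    unfolding h_def by (intro tendsto_intros t0)
  moreover have "A + t k *\<^sub>R h k \<in> psd_cone" for k
  proof -
    have "mat 1 \<in> (sym_mats :: (real^'m^'m) set)" by (simp add: sym_mats_def)
    then have "A + t k *\<^sub>R h k \<in> sym_mats"
      using A N unfolding h_def
      by (intro subspace_add subspace_scale subspace_sym_mats) (auto simp: psd_cone_def)
    moreover have "0 \<le> v \<bullet> ((A + t k *\<^sub>R h k) *v v)" for v
    proof -
      obtain u w where uw: "A *v u = 0" "\<And>k. A *v k = 0 \<Longrightarrow> w \<bullet> k = 0" "v = u + w"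
        using kernel_decomposition[of A v] by blast
      define a b T where "a = norm u" and "b = norm w" and "T = t k"
      have T: "0 < T" "T * n \<le> l / 2" using t by (auto simp: T_def)
      have "\<bar>u \<bullet> (N *v w)\<bar> \<le> a * (b * n)"
        using order_trans[OF Cauchy_Schwarz_ineq2 mult_left_mono[OF bound]] by (simp add: a_def b_def)
      moreover have "\<bar>w \<bullet> (N *v w)\<bar> \<le> b * (b * n)"
        using order_trans[OF Cauchy_Schwarz_ineq2 mult_left_mono[OF bound]] by (simp add: b_def)
      ultimately have N_bound: "- (2 * (a * (b * n)) + b * (b * n)) \<le> 2 * (u \<bullet> (N *v w)) + w \<bullet> (N *v w)"
        by linarith
      have vN: "v \<bullet> (N *v v) = 2 * (u \<bullet> (N *v w)) + w \<bullet> (N *v w)"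
        using sym_mats_selfadjoint[OF N, of w u] null[OF uw(1)]
        by (simp add: uw(3) matrix_vector_right_distrib inner_add_left inner_add_right inner_commute)
      have vA: "v \<bullet> (A *v v) = w \<bullet> (A *v w)"
        using A sym_mats_selfadjoint[of A u w] uw
        by (simp add: matrix_vector_right_distrib inner_add_left psd_cone_def)
      have vv: "v \<bullet> v = a\<^sup>2 + b\<^sup>2"
        using uw(2)[OF uw(1)]
        by (simp add: uw(3) inner_add_left inner_add_right a_def b_def power2_norm_eq_inner inner_commute)
      have eq: "v \<bullet> ((A + t k *\<^sub>R h k) *v v)
        = v \<bullet> (A *v v) + T * (v \<bullet> (N *v v) + T * c * (v \<bullet> v))"
        by (simp add: h_def T_def matrix_vector_mult_add_rdistrib scaleR_matrix_vector_assoc[symmetric]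
            inner_add_right)
      have "0 \<le> T * c" using T l by (simp add: c_def)
      then have "v \<bullet> (A *v v) + T * (v \<bullet> (N *v v) + T * c * (v \<bullet> v))
        \<ge> l * b\<^sup>2 + T * (- (2 * (a * (b * n)) + b * (b * n)) + T * c * (a\<^sup>2 + b\<^sup>2))"
        unfolding vA vv vN using T N_bound coercive[OF uw(2)]
        by (intro add_mono mult_left_mono) (auto simp: b_def)
      also have "l * b\<^sup>2 + T * (- (2 * (a * (b * n)) + b * (b * n)) + T * c * (a\<^sup>2 + b\<^sup>2))
        = (l / 2 - T * n) * b\<^sup>2 + T\<^sup>2 * c * b\<^sup>2 + (2 * T * n * a - l * b)\<^sup>2 / (2 * l)"
        using l by (simp add: c_def field_simps power2_eq_square)
      also have "\<dots> \<ge> 0" using T l n by (simp add: c_def)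
      finally show ?thesis unfolding eq .
    qed
    ultimately show ?thesis by (simp add: psd_cone_def)
  qed
  ultimately show ?thesis unfolding bouligand_tangent_cone_def using t(1) t0 by auto
qed

lemma subspace_null_on_kernel:
  "subspace {N \<in> sym_mats. \<forall>v. (A :: real^'m^'m) *v v = 0 \<longrightarrow> v \<bullet> (N *v v) = 0}"
proof -
  have "linear (\<lambda>N. v \<bullet> (N *v v))" for v :: "real^'m"
    by (rule linearI) (simp_all add: matrix_vector_mult_add_rdistrib inner_add_right
        scaleR_matrix_vector_assoc[symmetric])
  then have "subspace {N. v \<bullet> (N *v v) = 0}" for v :: "real^'m"
    by (rule linear_subspace_kernel)
  then have "subspace (sym_mats \<inter> (\<Inter>v\<in>{v. A *v v = 0}. {N. v \<bullet> (N *v v) = 0}))"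
    by (intro subspace_inter subspace_sym_mats subspace_Inter) auto
  also have "sym_mats \<inter> (\<Inter>v\<in>{v. A *v v = 0}. {N. v \<bullet> (N *v v) = 0})
    = {N \<in> sym_mats. \<forall>v. A *v v = 0 \<longrightarrow> v \<bullet> (N *v v) = 0}" by blast
  finally show ?thesis .
qed

text \<open>A subspace of tangent directions contains \<open>N\<close> and \<open>- N\<close>, so
  the inequality on the kernel becomes an equality. For symmetric \<open>N\<close>, polarisation
  makes this the condition \<open>E^T N E = 0\<close>, stated without choosing
  \<open>E\<close>.\<close>

lemma lin_tangent_cone_psd_cone:
  assumes A: "(A :: real^'m^'m) \<in> psd_cone"
  shows "lin (bouligand_tangent_cone psd_cone A)
    = {N \<in> sym_mats. \<forall>v. A *v v = 0 \<longrightarrow> v \<bullet> (N *v v) = 0}" (is "lin ?T = ?L")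
  unfolding lin_def
proof (rule Greatest_equality)
  show "subspace ?L \<and> ?L \<subseteq> ?T" using subspace_null_on_kernel tangent_cone_psd_coneI[OF A] by blast
next
  fix V assume V: "subspace V \<and> V \<subseteq> ?T"
  show "V \<subseteq> ?L"
  proof (intro subsetI CollectI conjI allI impI)
    fix N v assume N: "N \<in> V" and v: "A *v v = 0"
    have "- N \<in> V" using V N by (simp add: subspace_neg)
    moreover have "- N *v v = - (N *v v)" by (rule linear_neg[OF linear_matrix_vector_left])
    ultimately have "0 \<le> v \<bullet> (N *v v)" "0 \<le> - (v \<bullet> (N *v v))"
      using tangent_cone_psd_coneD(2)[OF A _ v] V N by force+
    then show "v \<bullet> (N *v v) = 0" by simp
  qed (use V tangent_cone_psd_coneD(1)[OF A] in blast)
qed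

section \<open>Derivatives of \<open>G\<close> and the vectors \<open>v_ij\<close>\<close>

text \<open>Transposition is linear and fixes the curve
  \<open>t \<mapsto> G (x + t *\<^sub>R axis l 1)\<close>, so by uniqueness it fixes the
  derivative.\<close>

lemma partial_derivative_in_sym_mats:
  fixes G :: "real^'n \<Rightarrow> real^'m^'m"
  assumes "continuously_differentiable G" and G: "\<And>y. G y \<in> sym_mats"
  shows "partial_derivative G l x \<in> sym_mats"
proof -
  obtain f' where "(G has_derivative blinfun_apply f') (at x)"
    using assms(1) by (auto simp: continuously_differentiable_def)
  then have "(G has_derivative blinfun_apply f') (at (x + 0 *\<^sub>R axis l 1))" by simp
  moreover have "((\<lambda>t. x + t *\<^sub>R axis l 1) has_derivative (\<lambda>t. t *\<^sub>R axis l 1)) (at (0::real))"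
    by (auto intro!: derivative_eq_intros)
  ultimately have "((\<lambda>t. G (x + t *\<^sub>R axis l 1)) has_derivative (\<lambda>t. f' (t *\<^sub>R axis l 1))) (at (0::real))"
    using has_derivative_compose[of "\<lambda>t. x + t *\<^sub>R axis l 1" _ 0 UNIV G] by simp
  then have vd: "((\<lambda>t. G (x + t *\<^sub>R axis l 1)) has_vector_derivative f' (axis l 1)) (at (0::real))"
    by (simp add: has_vector_derivative_def blinfun.scaleR_right)
  have "((\<lambda>t. transpose (G (x + t *\<^sub>R axis l 1))) has_vector_derivative transpose (f' (axis l 1))) (at (0::real))"
    using bounded_linear.has_vector_derivative[OF _ vd] linear_transpose
    by (simp add: linear_conv_bounded_linear)
  then have "((\<lambda>t. G (x + t *\<^sub>R axis l 1)) has_vector_derivative transpose (f' (axis l 1))) (at (0::real))"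
    using G by (simp add: sym_mats_def)
  then have "transpose (f' (axis l 1)) = f' (axis l 1)"
    using vd by (rule vector_derivative_unique_at)
  then show ?thesis
    using vd by (simp add: partial_derivative_def vector_derivative_at sym_mats_def)
qed

lemma linear_total_derivative: "linear (total_derivative G x)"
  by (auto intro!: linearI simp: total_derivative_def sum.distrib scaleR_sum_right algebra_simps)

lemma total_derivative_in_sym_mats:
  fixes G :: "real^'n \<Rightarrow> real^'m^'m"
  assumes "continuously_differentiable G" "\<And>y. G y \<in> sym_mats"
  shows "total_derivative G x d \<in> sym_mats"
  unfolding total_derivative_def
  using assms by (intro subspace_sum subspace_scale subspace_sym_mats partial_derivative_in_sym_mats)

text \<open>In other terms, \<open>v_vec G x e i j\<close> is the adjoint of the derivative applied
  to \<open>outer (e i) (e j)\<close>.\<close>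

lemma inner_v_vec: "d \<bullet> v_vec G x e i j = e i \<bullet> (total_derivative G x d *v e j)"
  by (simp add: total_derivative_def v_vec_def inner_vec_def[of d] linear_sum[OF linear_matrix_vector_left]
      scaleR_matrix_vector_assoc[symmetric] inner_sum_right)

text \<open>The right-hand side says that the matrix with terms
  \<open>c i *\<^sub>R outer (e i) (e i)\<close> is orthogonal to the image of the derivative; this
  links dependence relations with multipliers.\<close>

lemma sum_v_vec_eq_0_iff:
  fixes G :: "real^'n \<Rightarrow> real^'m^'m"
  shows "(\<Sum>i\<in>I. c i *\<^sub>R v_vec G x e i i) = 0
    \<longleftrightarrow> (\<forall>d. (\<Sum>i\<in>I. c i * (e i \<bullet> (total_derivative G x d *v e i))) = 0)"
proof -
  have "v = 0 \<longleftrightarrow> (\<forall>d. d \<bullet> v = 0)" for v :: "real^'n"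
    using vector_eq_ldot[of v 0] by simp
  then show ?thesis by (simp only: inner_sum_right inner_scaleR_right inner_v_vec)
qed

section \<open>Nondegeneracy and linear independence\<close>

text \<open>Nondegeneracy splits \<open>outer (e j) (e j)\<close> into a derivative and a lineality
  part. A dependence relation annihilates both, yet its value on \<open>outer (e j) (e j)\<close> is
  the coefficient \<open>c j\<close>.\<close>

lemma nondegenerate_imp_lin_indep:
  fixes G :: "real^'n \<Rightarrow> real^'m^'m"
  assumes A: "G x \<in> psd_cone" and nd: "nondegenerate G x" and e: "spans_kernel e (G x)"
  shows "lin_indep_family {..<CARD('m) - rank (G x)} (\<lambda>i. v_vec G x e i i)"
  unfolding lin_indep_family_def
proof (intro allI impI ballI)
  let ?I = "{..<CARD('m) - rank (G x)}"
  fix c j assume c: "(\<Sum>i\<in>?I. c i *\<^sub>R v_vec G x e i i) = 0" and j: "j \<in> ?I"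
  have "outer (e j) (e j) \<in> sym_mats" by (simp add: sym_mats_def transpose_outer)
  with nd have "outer (e j) (e j) \<in> range (total_derivative G x)
      + {N \<in> sym_mats. \<forall>v. G x *v v = 0 \<longrightarrow> v \<bullet> (N *v v) = 0}"
    by (simp add: nondegenerate_def lin_tangent_cone_psd_cone[OF A])
  then obtain d N where N: "\<And>v. G x *v v = 0 \<Longrightarrow> v \<bullet> (N *v v) = 0"
    and eq: "outer (e j) (e j) = total_derivative G x d + N"
    by (elim set_plus_elim) auto
  have "c j = (\<Sum>i\<in>?I. c i * (e i \<bullet> (outer (e j) (e j) *v e i)))"
  proof -
    have "(\<Sum>i\<in>?I. c i * (e i \<bullet> (outer (e j) (e j) *v e i))) = (\<Sum>i\<in>?I. if i = j then c j else 0)"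
      using e j by (intro sum.cong) (auto simp: outer_mult_vec spans_kernel_def)
    then show ?thesis using j by simp
  qed
  also have "\<dots> = (\<Sum>i\<in>?I. c i * (e i \<bullet> (total_derivative G x d *v e i)))"
    using e N unfolding eq
    by (intro sum.cong) (auto simp: matrix_vector_mult_add_rdistrib inner_add_right spans_kernel_def)
  also have "\<dots> = 0" using c by (simp add: sum_v_vec_eq_0_iff)
  finally show "c j = 0" .
qed

text \<open>If the sum \<open>R + L\<close> is a proper subspace, a nonzero symmetric
  \<open>Y\<close> is orthogonal to it. Orthogonality to \<open>L\<close> puts the range of
  \<open>Y\<close> in the kernel, and orthogonality to \<open>R\<close> makes its eigenvalues a
  dependence relation.\<close>

lemma lin_indep_imp_nondegenerate:
  fixes G :: "real^'n \<Rightarrow> real^'m^'m"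
  assumes A: "G x \<in> psd_cone" and D: "range (total_derivative G x) \<subseteq> sym_mats"
    and indep: "\<And>e. spans_kernel e (G x) \<Longrightarrow>
      lin_indep_family {..<CARD('m) - rank (G x)} (\<lambda>i. v_vec G x e i i)"
  shows "nondegenerate G x"
proof (rule ccontr)
  define L where "L = {N \<in> sym_mats. \<forall>v. G x *v v = 0 \<longrightarrow> v \<bullet> (N *v v) = 0}"
  define R where "R = range (total_derivative G x)"
  assume "\<not> nondegenerate G x"
  then have ne: "R + L \<noteq> sym_mats"
    by (simp add: nondegenerate_def lin_tangent_cone_psd_cone[OF A] L_def R_def)
  have subR: "subspace R"
    unfolding R_def using linear_subspace_image[OF linear_total_derivative subspace_UNIV] .
  have subL: "subspace L"
    unfolding L_def by (rule subspace_null_on_kernel)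
  have "R + L = {r + l |r l. r \<in> R \<and> l \<in> L}" by (auto simp: set_plus_def)
  then have sub: "subspace (R + L)" using subspace_sums[OF subR subL] by simp
  have "R + L \<subseteq> sym_mats"
  proof
    fix M assume "M \<in> R + L"
    then obtain r l where "M = r + l" "r \<in> R" "l \<in> L" by (rule set_plus_elim)
    then show "M \<in> sym_mats"
      using D subspace_add[OF subspace_sym_mats, of r l] by (auto simp: R_def L_def)
  qed
  then have "span (R + L) \<subset> span sym_mats"
    using ne unfolding span_eq_iff[THEN iffD2, OF sub] span_eq_iff[THEN iffD2, OF subspace_sym_mats]
    by blast
  from orthogonal_to_subspace_exists_gen[OF this]
  obtain Y where Y: "Y \<noteq> 0" "Y \<in> span sym_mats" "\<And>M. M \<in> span (R + L) \<Longrightarrow> orthogonal Y M"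
    by blast
  have Ysym: "Y \<in> sym_mats"
    using Y(2) unfolding span_eq_iff[THEN iffD2, OF subspace_sym_mats] .
  have YM: "Y \<bullet> M = 0" if "M \<in> R + L" for M
    using Y(3)[OF span_base[OF that]] by (simp add: orthogonal_def)
  have YR: "Y \<bullet> total_derivative G x d = 0" for d
    using YM[OF set_plus_intro[of "total_derivative G x d" R 0 L]] subspace_0[OF subL]
    by (simp add: R_def)
  have YL: "Y \<bullet> N = 0" if "N \<in> L" for N
    using YM[OF set_plus_intro[of 0 R N L]] subspace_0[OF subR] that by simp
  have ran: "G x *v (Y *v u) = 0" for u
  proof -
    obtain k w where kw: "G x *v k = 0" "\<And>k. G x *v k = 0 \<Longrightarrow> w \<bullet> k = 0" "Y *v u = k + w"
      using kernel_decomposition[of "G x" "Y *v u"] by blast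
    \<comment> \<open>With \<open>w\<close> the component of \<open>Y *v u\<close> orthogonal to the
      kernel, this matrix lies in \<open>L\<close>, and its pairing with \<open>Y\<close> is
      \<open>2 * (w \<bullet> w)\<close>, which forces \<open>w = 0\<close>.\<close>
    have "outer w u + outer u w \<in> sym_mats"
      by (simp add: sym_mats_def linear_add[OF linear_transpose] transpose_outer add.commute)
    moreover have "v \<bullet> ((outer w u + outer u w) *v v) = 0" if "G x *v v = 0" for v
      using kw(2)[OF that]
      by (simp add: matrix_vector_mult_add_rdistrib outer_mult_vec inner_add_right inner_commute[of v w])
    ultimately have "outer w u + outer u w \<in> L" by (simp add: L_def)
    then have "w \<bullet> (Y *v u) + u \<bullet> (Y *v w) = 0"
      using YL[of "outer w u + outer u w"] by (simp add: inner_add_right inner_outer)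
    then have "w \<bullet> (Y *v u) = 0"
      using sym_mats_selfadjoint[OF Ysym, of u w] by (simp add: inner_commute)
    then have "w = 0" using kw by (simp add: inner_add_right)
    then show ?thesis using kw by simp
  qed
  obtain e c where e: "spans_kernel e (G x)"
    and Yeq: "Y = (\<Sum>i<CARD('m) - rank (G x). c i *\<^sub>R outer (e i) (e i))"
    using symmetric_spectral_decomposition[OF Ysym ran] by blast
  have "(\<Sum>i<CARD('m) - rank (G x). c i *\<^sub>R v_vec G x e i i) = 0"
    unfolding sum_v_vec_eq_0_iff
  proof
    fix d
    have "total_derivative G x d \<bullet> Y = 0" using YR by (simp add: inner_commute)
    then show "(\<Sum>i<CARD('m) - rank (G x). c i * (e i \<bullet> (total_derivative G x d *v e i))) = 0"
      by (simp add: Yeq inner_sum_right inner_outer)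
  qed
  with indep[OF e] have "Y = 0" unfolding lin_indep_family_def Yeq by (simp add: sum.neutral)
  with Y show False by simp
qed

section \<open>Robinson's condition and positive linear independence\<close>

text \<open>On kernel vectors \<open>G x\<close> contributes nothing, so a Robinson direction
  \<open>d\<close> has positive inner product with every \<open>v_ii\<close>; a nonnegative
  combination can vanish only trivially.\<close>

lemma robinson_cq_imp_pos_lin_indep:
  fixes G :: "real^'n \<Rightarrow> real^'m^'m"
  assumes "robinson_cq G x" and e: "spans_kernel e (G x)"
  shows "pos_lin_indep_family {..<CARD('m) - rank (G x)} (\<lambda>i. v_vec G x e i i)"
  unfolding pos_lin_indep_family_def
proof (intro allI impI, elim conjE)
  let ?I = "{..<CARD('m) - rank (G x)}"
  fix c assume c: "\<forall>i\<in>?I. 0 \<le> c i" "(\<Sum>i\<in>?I. c i *\<^sub>R v_vec G x e i i) = 0"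
  obtain d where d: "pos_definite (G x + total_derivative G x d)"
    using assms(1) by (auto simp: robinson_cq_def)
  have pos: "0 < e i \<bullet> (total_derivative G x d *v e i)" if "i \<in> ?I" for i
  proof -
    have "e i \<bullet> e i = 1" "G x *v e i = 0" using e that by (auto simp: spans_kernel_def)
    moreover from this have "e i \<noteq> 0" by auto
    ultimately show ?thesis
      using d by (auto simp: pos_definite_def matrix_vector_mult_add_rdistrib)
  qed
  have "(\<Sum>i\<in>?I. c i * (e i \<bullet> (total_derivative G x d *v e i))) = 0"
    using c(2) by (simp add: sum_v_vec_eq_0_iff)
  then have "\<forall>i\<in>?I. c i * (e i \<bullet> (total_derivative G x d *v e i)) = 0"
    using c(1) pos by (subst (asm) sum_nonneg_eq_0_iff) (auto simp: less_imp_le)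
  then show "\<forall>i\<in>?I. c i = 0" using pos by fastforce
qed

text \<open>A hyperplane separates the affine set \<open>C\<close> from the convex cone
  \<open>P\<close>. Its normal \<open>Y\<close> turns out positive semidefinite, orthogonal to the
  image of the derivative and complementary to \<open>G x\<close>.\<close>

lemma pos_lin_indep_imp_robinson_cq:
  fixes G :: "real^'n \<Rightarrow> real^'m^'m"
  assumes A: "G x \<in> psd_cone" and D: "range (total_derivative G x) \<subseteq> sym_mats"
    and indep: "\<And>e. spans_kernel e (G x) \<Longrightarrow>
      pos_lin_indep_family {..<CARD('m) - rank (G x)} (\<lambda>i. v_vec G x e i i)"
  shows "robinson_cq G x"
proof (rule ccontr)
  assume not: "\<not> robinson_cq G x"
  \<comment> \<open>Not restricted to symmetric matrices: pairing with the antisymmetric ones then forces the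
    separating matrix to be symmetric.\<close>
  define P where "P = {B :: real^'m^'m. \<forall>v. v \<noteq> 0 \<longrightarrow> 0 < v \<bullet> (B *v v)}"
  define C where "C = range (\<lambda>d. G x + total_derivative G x d)"
  have "C = (+) (G x) ` range (total_derivative G x)" by (auto simp: C_def)
  then have "convex C"
    using convex_translation[OF subspace_imp_convex[OF
        linear_subspace_image[OF linear_total_derivative subspace_UNIV]]] by simp
  moreover have "convex P"
    unfolding convex_alt P_def
  proof (intro ballI allI impI CollectI, elim conjE CollectE)
    fix B B' :: "real^'m^'m" and s :: real and v :: "real^'m"
    assume *: "\<forall>v. v \<noteq> 0 \<longrightarrow> 0 < v \<bullet> (B *v v)" "\<forall>v. v \<noteq> 0 \<longrightarrow> 0 < v \<bullet> (B' *v v)"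
      "0 \<le> s" "s \<le> 1" "v \<noteq> 0"
    have "0 < (1 - s) * (v \<bullet> (B *v v)) + s * (v \<bullet> (B' *v v))"
    proof (cases "s = 0")
      case False
      then show ?thesis using * by (intro add_nonneg_pos) (auto intro: less_imp_le)
    qed (use * in auto)
    then show "0 < v \<bullet> (((1 - s) *\<^sub>R B + s *\<^sub>R B') *v v)"
      by (simp add: matrix_vector_mult_add_rdistrib scaleR_matrix_vector_assoc[symmetric] inner_add_right)
  qed
  moreover have "mat 1 \<in> P" by (simp add: P_def)
  moreover have "C \<inter> P = {}"
  proof -
    have "G x + total_derivative G x d \<in> sym_mats" for d
      using A D subspace_sym_mats by (intro subspace_add) (auto simp: psd_cone_def)
    then show ?thesis using not by (auto simp: C_def P_def robinson_cq_def pos_definite_def)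
  qed
  moreover have "C \<noteq> {}" by (simp add: C_def)
  ultimately obtain Y b where Y: "Y \<noteq> 0" and YC: "\<And>M. M \<in> C \<Longrightarrow> Y \<bullet> M \<le> b"
    and YP: "\<And>B. B \<in> P \<Longrightarrow> b \<le> Y \<bullet> B"
    using separating_hyperplane_sets[of C P] by blast
  have YP0: "0 \<le> Y \<bullet> B" if "B \<in> P" for B
  proof (rule ccontr)
    assume "\<not> 0 \<le> Y \<bullet> B"
    then have neg: "Y \<bullet> B < 0" by simp
    \<comment> \<open>\<open>P\<close> is closed under positive scaling; this factor brings the
      value down to \<open>- (\<bar>b\<bar> + 1)\<close>, below \<open>b\<close>.\<close>
    define s where "s = (\<bar>b\<bar> + 1) / - (Y \<bullet> B)"
    have "0 < s" using neg by (simp add: s_def divide_simps)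
    then have "s *\<^sub>R B \<in> P" using that by (simp add: P_def scaleR_matrix_vector_assoc[symmetric])
    then have "b \<le> s * (Y \<bullet> B)" using YP by force
    also have "\<dots> = - (\<bar>b\<bar> + 1)" using neg by (simp add: s_def)
    finally show False by linarith
  qed
  \<comment> \<open>Both bounds extend from \<open>P\<close> to matrices with nonnegative form by
    adding \<open>s *\<^sub>R mat 1\<close> and letting \<open>s\<close> decrease to
    \<open>0\<close>.\<close>
  have approx: "b \<le> Y \<bullet> B" "0 \<le> Y \<bullet> B" if B: "\<And>v. 0 \<le> v \<bullet> (B *v v)" for B
  proof -
    have "B + s *\<^sub>R mat 1 \<in> P" if "0 < s" for s
      using B that by (auto simp: P_def quadratic_form_add_scaled_mat intro!: add_nonneg_pos)
    then have *: "b \<le> Y \<bullet> B + s * (Y \<bullet> mat 1)" "0 \<le> Y \<bullet> B + s * (Y \<bullet> mat 1)" if "0 < s" for s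
      using YP[of "B + s *\<^sub>R mat 1"] YP0[of "B + s *\<^sub>R mat 1"] that by (auto simp: inner_add_right)
    have "((\<lambda>s. Y \<bullet> B + s * (Y \<bullet> mat 1)) \<longlongrightarrow> Y \<bullet> B + 0 * (Y \<bullet> mat 1)) (at_right (0::real))"
      by (intro tendsto_intros)
    then show "b \<le> Y \<bullet> B" "0 \<le> Y \<bullet> B"
      using * by (auto intro!: tendsto_lowerbound simp: eventually_at_right_less elim: eventually_mono[OF eventually_at_right_less])
  qed
  have b: "b \<le> 0" using approx(1)[of 0] by simp
  have YA: "Y \<bullet> G x \<le> 0"
  proof -
    have "G x + total_derivative G x 0 \<in> C" by (auto simp: C_def)
    then have "Y \<bullet> (G x + total_derivative G x 0) \<le> b" by (rule YC)
    then show ?thesis using b linear_0[OF linear_total_derivative, of G x] by simp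
  qed
  have YR: "Y \<bullet> total_derivative G x d = 0" for d
  proof (rule ccontr)
    assume ne: "Y \<bullet> total_derivative G x d \<noteq> 0"
    \<comment> \<open>A functional bounded above on a line is constant there: this \<open>s\<close>
      would give the value \<open>b + 1\<close> on \<open>C\<close>.\<close>
    define s where "s = (b + 1 - Y \<bullet> G x) / (Y \<bullet> total_derivative G x d)"
    have "Y \<bullet> (G x + total_derivative G x (s *\<^sub>R d)) \<le> b" by (rule YC) (auto simp: C_def)
    then show False
      using ne by (simp add: linear_scale[OF linear_total_derivative] inner_add_right s_def)
  qed
  have Ysym: "Y \<in> sym_mats"
  proof -
    \<comment> \<open>The form of the antisymmetric \<open>S\<close> vanishes, so
      \<open>approx\<close> gives \<open>0 \<le> Y \<bullet> S\<close>; but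
      \<open>S \<bullet> S = - 2 * (Y \<bullet> S)\<close>.\<close>
    define S where "S = transpose Y - Y"
    have "transpose S = - S"
      by (simp add: S_def linear_diff[OF linear_transpose])
    then have "v \<bullet> (S *v v) = 0" for v
    proof -
      have "v \<bullet> (S *v v) = (transpose S *v v) \<bullet> v" by (simp add: dot_lmul_matrix)
      also have "\<dots> = - (v \<bullet> (S *v v))"
        using \<open>transpose S = - S\<close> linear_neg[OF linear_matrix_vector_left, of S v]
        by (simp add: inner_commute del: transpose_matrix_vector)
      finally show ?thesis by simp
    qed
    then have "0 \<le> Y \<bullet> S" by (intro approx) simp
    moreover have "transpose Y \<bullet> transpose Y = Y \<bullet> Y" by (rule inner_transpose)
    ultimately have "S \<bullet> S \<le> 0"
      by (simp add: S_def inner_diff_left inner_diff_right inner_commute)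
    then have "S = 0" using inner_ge_zero[of S] inner_eq_zero_iff[of S] by linarith
    then show ?thesis by (simp add: S_def sym_mats_def)
  qed
  have Ypsd: "0 \<le> u \<bullet> (Y *v u)" for u
    using approx(2)[of "outer u u"] by (simp add: outer_mult_vec inner_outer inner_commute)
  have ran: "G x *v (Y *v u) = 0" for u
  proof -
    \<comment> \<open>Diagonalising \<open>Y\<close> on the whole space, which is the kernel of the zero matrix.\<close>
    obtain e c where e: "spans_kernel e (0 :: real^'m^'m)"
      and ec: "\<And>i. i < CARD('m) \<Longrightarrow> Y *v e i = c i *\<^sub>R e i"
      and Yeq: "Y = (\<Sum>i<CARD('m). c i *\<^sub>R outer (e i) (e i))"
      using symmetric_spectral_decomposition[OF Ysym, of 0] by auto
    have c: "0 \<le> c i" if "i < CARD('m)" for i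
      using Ypsd[of "e i"] ec[OF that] e that by (simp add: spans_kernel_def)
    have Ae: "0 \<le> e i \<bullet> (G x *v e i)" for i using A by (simp add: psd_cone_def)
    \<comment> \<open>Complementarity: \<open>Y \<bullet> G x \<le> 0\<close> is a sum of
      nonnegative terms, so each vanishes, and \<open>psd_cone_null\<close> gives
      \<open>G x *v e i = 0\<close> wherever \<open>c i\<close> is nonzero.\<close>
    have "(\<Sum>i<CARD('m). c i * (e i \<bullet> (G x *v e i))) = G x \<bullet> Y"
      by (simp add: Yeq inner_sum_right inner_outer)
    then have "(\<Sum>i<CARD('m). c i * (e i \<bullet> (G x *v e i))) = 0"
      using YA c Ae by (intro antisym sum_nonneg) (auto simp: inner_commute)
    then have "c i * (e i \<bullet> (G x *v e i)) = 0" if "i < CARD('m)" for i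
      using c Ae that by (subst (asm) sum_nonneg_eq_0_iff) auto
    then have z: "c i *\<^sub>R (G x *v e i) = 0" if "i < CARD('m)" for i
      using psd_cone_null[OF A] that by fastforce
    have "Y *v u = (\<Sum>i<CARD('m). (c i * (e i \<bullet> u)) *\<^sub>R e i)"
      by (simp add: Yeq linear_sum[OF linear_matrix_vector_left] scaleR_matrix_vector_assoc[symmetric]
          outer_mult_vec)
    then have "G x *v (Y *v u) = (\<Sum>i<CARD('m). (e i \<bullet> u) *\<^sub>R c i *\<^sub>R (G x *v e i))"
      by (simp add: linear_sum[OF matrix_vector_mul_linear] matrix_vector_mult_scaleR mult.commute)
    then show ?thesis using z by simp
  qed
  obtain e c where e: "spans_kernel e (G x)"
    and ec: "\<And>i. i < CARD('m) - rank (G x) \<Longrightarrow> Y *v e i = c i *\<^sub>R e i"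
    and Yeq: "Y = (\<Sum>i<CARD('m) - rank (G x). c i *\<^sub>R outer (e i) (e i))"
    using symmetric_spectral_decomposition[OF Ysym ran] by blast
  have c: "0 \<le> c i" if "i < CARD('m) - rank (G x)" for i
    using Ypsd[of "e i"] ec[OF that] e that by (simp add: spans_kernel_def)
  have "(\<Sum>i<CARD('m) - rank (G x). c i *\<^sub>R v_vec G x e i i) = 0"
    unfolding sum_v_vec_eq_0_iff
  proof
    fix d
    have "total_derivative G x d \<bullet> Y = 0" using YR by (simp add: inner_commute)
    then show "(\<Sum>i<CARD('m) - rank (G x). c i * (e i \<bullet> (total_derivative G x d *v e i))) = 0"
      by (simp add: Yeq inner_sum_right inner_outer)
  qed
  with indep[OF e] c have "Y = 0" unfolding pos_lin_indep_family_def Yeq by (simp add: sum.neutral)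
  with Y show False by simp
qed

theorem proposition3p2:
  fixes G :: "real^'n \<Rightarrow> real^'m^'m" and x :: "real^'n"
  assumes "\<And>y. G y \<in> sym_mats"
    and "continuously_differentiable G"
    and "G x \<in> psd_cone"
  shows "(nondegenerate G x \<longleftrightarrow>
            rank (G x) = CARD('m) \<or>
            (\<forall>e. spans_kernel e (G x) \<longrightarrow>
               lin_indep_family {..<CARD('m) - rank (G x)} (\<lambda>i. v_vec G x e i i)))
       \<and> (robinson_cq G x \<longleftrightarrow>
            rank (G x) = CARD('m) \<or>
            (\<forall>e. spans_kernel e (G x) \<longrightarrow>
               pos_lin_indep_family {..<CARD('m) - rank (G x)} (\<lambda>i. v_vec G x e i i)))"
proof -
  have D: "range (total_derivative G x) \<subseteq> sym_mats"
    using total_derivative_in_sym_mats[OF assms(2,1)] by blast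
  \<comment> \<open>At full rank the index set is empty and both families are trivially independent,
    so the first disjunct is a case of the second.\<close>
  have "lin_indep_family {..<CARD('m) - rank (G x)} (\<lambda>i. v_vec G x e i i)"
    "pos_lin_indep_family {..<CARD('m) - rank (G x)} (\<lambda>i. v_vec G x e i i)"
    if "rank (G x) = CARD('m)" for e
    using that by (simp_all add: lin_indep_family_def pos_lin_indep_family_def)
  then show ?thesis
    using nondegenerate_imp_lin_indep[where G = G and x = x, OF assms(3)]
      lin_indep_imp_nondegenerate[where G = G and x = x, OF assms(3) D]
      robinson_cq_imp_pos_lin_indep[where G = G and x = x]
      pos_lin_indep_imp_robinson_cq[where G = G and x = x, OF assms(3) D]
    by blast
qed

end
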